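(* Let $T$ be an operator given, for compactly supported $f\in\bigcup_{q\in(1,\infty)}L^q(\mathbb{R}^n)$, by $$Tf(x)=\int_{\mathbb{R}^n}K(x,y)f(y)\,dy\qquad\text{for almost every }x\notin\operatorname{supp} f,$$ where $K:\mathbb{R}^{2n}\setminus\{(x,x):x\in\mathbb{R}^n\}\to\mathbb{C}$. Suppose there exist measurable functions $s,\phi,\psi\in L^0(\mathbb{R}^n)$ such that $|s|=1$, $\phi$ and $\psi$ are nonnegative, $\operatorname{supp}\phi\cap\operatorname{supp}\psi$ is a null set, and, for almost every $x\in\operatorname{supp}\phi$ and $y\in\operatorname{supp}\psi$, the number $s(y)K(x,y)$ is real and $$s(y)K(x,y)\ \ge\ \phi(x)\psi(y).$$ Then $$\|T\|_{L^p(w)\to X}\ \ge\ \|\phi\|_X\,\|\psi\|_{L^{p'}(\sigma)}$$ for every $p\in(1,\infty)$, every $w\in A_p$, and every monotone functional $\|\cdot\|_X:L^0(\mathbb{R}^n)\to[0,\infty]$, where $p'=\frac p{p-1}$ and $\sigma=w^{1-p'}$.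
   Context: $L^0(\mathbb{R}^n)$ is the space of measurable functions on $\mathbb{R}^n$. A map $\|\cdot\|_X:L^0(\mathbb{R}^n)\to[0,\infty]$ is a monotone functional if $\|f\|_X\ge\|g\|_X$ whenever $|f|\ge|g|$ almost everywhere and $\|af\|_X=a\|f\|_X$ for all $a\ge0$, with the convention $0\cdot\infty=0$ (also used in the product in the conclusion). A weight is a locally integrable function on $\mathbb{R}^n$ that is positive almost everywhere. $w\in A_p$ means that $w$ is a weight with $[w]_{A_p}:=\sup_Q \langle w\rangle_Q\langle w^{1-p'}\rangle_Q^{p-1}<\infty$, the supremum being over all cubes $Q\subseteq\mathbb{R}^n$, where $\langle g\rangle_Q=\frac1{|Q|}\int_Qg\,dx$. $\|f\|_{L^p(w)}=\left(\int|f|^pw\,dx\right)^{1/p}$, and similarly for $\|\cdot\|_{L^{p'}(\sigma)}$. $\|T\|_{L^p(w)\to X}$ is the infimum of all $C>0$ such that $\|Tf\|_X\le C\|f\|_{L^p(w)}$ for all $f\in L^p(w)$ on which $T$ is defined (the domain of $T$ contains all compactly supported functions in $\bigcup_{q\in(1,\infty)}L^q(\mathbb{R}^n)$, and $Tf\in L^0(\mathbb{R}^n)$), and $\|T\|_{L^p(w)\to X}=\infty$ if there is no such $C$. *)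

theory Defs
  imports "HOL-Analysis.Analysis"
begin

text \<open>Elements of \<open>L\<^sup>0\<close> and \<open>L\<^sup>p(w)\<close> are complex-valued functions, not classes modulo
  almost everywhere equality.\<close>

definition L0 :: "('a::euclidean_space \<Rightarrow> complex) set" where
  "L0 = borel_measurable lebesgue"

definition monotone_functional :: "(('a::euclidean_space \<Rightarrow> complex) \<Rightarrow> ennreal) \<Rightarrow> bool" where
  "monotone_functional X \<longleftrightarrow>
     (\<forall>f\<in>L0. \<forall>g\<in>L0. (AE x in lebesgue. cmod (g x) \<le> cmod (f x)) \<longrightarrow> X g \<le> X f) \<and>
     (\<forall>f\<in>L0. \<forall>a\<ge>0. X (\<lambda>x. complex_of_real a * f x) = ennreal a * X f)"

definition weight :: "('a::euclidean_space \<Rightarrow> real) \<Rightarrow> bool" where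
  "weight w \<longleftrightarrow> (\<forall>C. compact C \<longrightarrow> set_integrable lebesgue C w) \<and> (AE x in lebesgue. 0 < w x)"

definition conj_exp :: "real \<Rightarrow> real" where
  "conj_exp p = p / (p - 1)"

text \<open>The power \<open>t\<^sup>r\<close> of \<open>t \<in> [0,\<infinity>]\<close>, used for \<open>r > 0\<close> only.\<close>

definition ennreal_powr :: "ennreal \<Rightarrow> real \<Rightarrow> ennreal" where
  "ennreal_powr t r = (if t = \<infinity> then \<infinity> else ennreal (enn2real t powr r))"

definition cubes :: "'a::euclidean_space set set" where
  "cubes = {cbox a (a + h *\<^sub>R One) | a h. 0 < h}"

text \<open>For a function \<open>g\<close> that is nonnegative almost everywhere; the value is \<open>\<infinity>\<close> if \<open>g\<close> is not
  integrable on \<open>Q\<close>.\<close>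

definition average :: "'a::euclidean_space set \<Rightarrow> ('a \<Rightarrow> real) \<Rightarrow> ennreal" where
  "average Q g = (\<integral>\<^sup>+x\<in>Q. ennreal (g x) \<partial>lebesgue) / emeasure lebesgue Q"

definition Ap_constant :: "real \<Rightarrow> ('a::euclidean_space \<Rightarrow> real) \<Rightarrow> ennreal" where
  "Ap_constant p w = (SUP Q\<in>cubes.
     average Q w * ennreal_powr (average Q (\<lambda>x. w x powr (1 - conj_exp p))) (p - 1))"

definition Ap :: "real \<Rightarrow> ('a::euclidean_space \<Rightarrow> real) set" where
  "Ap p = {w. weight w \<and> Ap_constant p w < \<infinity>}"

definition Lp_norm ::
    "real \<Rightarrow> ('a::euclidean_space \<Rightarrow> real) \<Rightarrow> ('a \<Rightarrow> complex) \<Rightarrow> ennreal" where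
  "Lp_norm p w f = ennreal_powr (\<integral>\<^sup>+x. ennreal (cmod (f x) powr p * w x) \<partial>lebesgue) (1 / p)"

definition Lp_space :: "real \<Rightarrow> ('a::euclidean_space \<Rightarrow> real) \<Rightarrow> ('a \<Rightarrow> complex) set" where
  "Lp_space p w = {f \<in> L0. Lp_norm p w f < \<infinity>}"

text \<open>\<open>\<parallel>T\<parallel>\<close> from \<open>L\<^sup>p(w)\<close> to \<open>X\<close> for an operator \<open>T\<close> with domain \<open>D\<close>; the infimum of the empty
  set is \<open>\<infinity>\<close>.\<close>

definition operator_norm :: "('a::euclidean_space \<Rightarrow> complex) set \<Rightarrow>
    (('a \<Rightarrow> complex) \<Rightarrow> 'a \<Rightarrow> complex) \<Rightarrow> real \<Rightarrow> ('a \<Rightarrow> real) \<Rightarrow>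
    (('a \<Rightarrow> complex) \<Rightarrow> ennreal) \<Rightarrow> ennreal" where
  "operator_norm D T p w X =
     Inf {ennreal C | C. 0 < C \<and> (\<forall>f \<in> D \<inter> Lp_space p w. X (T f) \<le> ennreal C * Lp_norm p w f)}"

text \<open>Two notions of support occur. That of an argument \<open>f\<close> of an operator is the closed support;
  for \<open>\<phi>\<close> and \<open>\<psi>\<close>, which are only measurable, \<^const>\<open>support_on\<close> gives the set where the function
  does not vanish. With these choices the hypotheses below on the operator and on \<open>\<phi>\<close>, \<open>\<psi>\<close> are
  implied by the corresponding ones for closed, essential closed or pointwise supports throughout.\<close>

definition supp :: "('a::euclidean_space \<Rightarrow> complex) \<Rightarrow> 'a set" where
  "supp f = closure (support_on UNIV f)"

definition test_functions :: "('a::euclidean_space \<Rightarrow> complex) set" where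
  "test_functions = {f. compact (supp f) \<and> (\<exists>q>1. f \<in> Lp_space q (\<lambda>_. 1))}"

text \<open>\<open>T\<close> is an operator with domain \<open>D\<close>, not assumed linear. Convergence of the integral is part
  of the formula for \<open>T f x\<close>. The values \<open>K x x\<close> are irrelevant here and in \<open>kernel_lower_bound\<close>,
  as singletons are null sets.\<close>

definition kernel_operator :: "('a::euclidean_space \<Rightarrow> complex) set \<Rightarrow>
    (('a \<Rightarrow> complex) \<Rightarrow> 'a \<Rightarrow> complex) \<Rightarrow> ('a \<Rightarrow> 'a \<Rightarrow> complex) \<Rightarrow> bool" where
  "kernel_operator D T K \<longleftrightarrow>
     test_functions \<subseteq> D \<and> T \<in> D \<rightarrow> L0 \<and>
     (\<forall>f\<in>test_functions. AE x in lebesgue. x \<notin> supp f \<longrightarrow>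
        integrable lebesgue (\<lambda>y. K x y * f y) \<and> T f x = (\<integral>y. K x y * f y \<partial>lebesgue))"

definition kernel_lower_bound :: "('a::euclidean_space \<Rightarrow> 'a \<Rightarrow> complex) \<Rightarrow> ('a \<Rightarrow> complex) \<Rightarrow>
    ('a \<Rightarrow> real) \<Rightarrow> ('a \<Rightarrow> real) \<Rightarrow> bool" where
  "kernel_lower_bound K s \<phi> \<psi> \<longleftrightarrow>
     (AE x in lebesgue. x \<in> support_on UNIV \<phi> \<longrightarrow>
       (AE y in lebesgue. y \<in> support_on UNIV \<psi> \<longrightarrow>
          s y * K x y \<in> \<real> \<and> \<phi> x * \<psi> y \<le> Re (s y * K x y)))"

end

theory Submission
  imports Defs
begin

text \<open>Lower bounds for \<open>T\<close> come from the functions \<open>f = s \<cdot> g\<close> with \<open>g \<ge> 0\<close> living on a compact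
  set \<open>F\<close> on which \<open>\<psi>\<close> does not vanish. The factor \<open>s\<close> removes the phase of the kernel, so that for
  almost every \<open>x\<close> with \<open>\<phi> x \<noteq> 0\<close> no cancellation occurs in the integral defining \<open>T f x\<close>, and
  \<open>\<bar>T f x\<bar> \<ge> \<phi> x \<integral> \<psi> g\<close>. The functional \<open>X\<close> is monotone and homogeneous, hence
  \<open>X \<phi> \<cdot> \<integral> \<psi> g \<le> X (T f) \<le> C \<parallel>g\<parallel>\<close> with the norm of \<open>L\<^sup>p(w)\<close>, for every admissible constant \<open>C\<close>.
  Optimising over \<open>g\<close> is the converse of Hoelder's inequality: the extremal choice
  \<open>g = \<psi>\<^bsup>p'-1\<^esup> \<sigma>\<close> on \<open>F\<close> makes both \<open>\<integral> \<psi> g\<close> and \<open>\<parallel>g\<parallel>\<^sup>p\<close> equal to \<open>c = \<integral>\<^sub>F \<psi>\<^bsup>p'\<^esup> \<sigma>\<close>, and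
  dividing by \<open>c\<^bsup>1/p\<^esup>\<close> gives \<open>X \<phi> \<cdot> c\<^bsup>1/p'\<^esup> \<le> C\<close>.

  Compactness of \<open>F\<close> serves two purposes. The representation of \<open>T f\<close> holds only off the closed
  support of \<open>f\<close>, and the closure of the set where \<open>\<psi> \<noteq> 0\<close> could cover the set where \<open>\<phi> \<noteq> 0\<close>;
  since \<open>F\<close> is closed, the support of \<open>f\<close> stays inside \<open>F\<close>, where \<open>\<psi> \<noteq> 0\<close>, and so misses almost
  every \<open>x\<close> with \<open>\<phi> x \<noteq> 0\<close>. Moreover \<open>F\<close> can be
  taken such that \<open>g\<close> and \<open>\<psi>\<close> are bounded on it, which makes \<open>f\<close> a test function and \<open>c\<close> finite.
  Inner regularity of Lebesgue measure supplies an increasing sequence of such sets which fills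
  the set where \<open>\<psi> > 0\<close> up to a null set, and monotone convergence turns the bounds for \<open>F\<close>
  into the bound for \<open>\<psi>\<close>.\<close>

section \<open>Powers of extended nonnegative numbers\<close>

lemma ennreal_powr_ennreal: "0 \<le> c \<Longrightarrow> ennreal_powr (ennreal c) r = ennreal (c powr r)"
  by (simp add: ennreal_powr_def)

lemma ennreal_powr_mono:
  assumes "t \<le> u" "0 \<le> r"
  shows "ennreal_powr t r \<le> ennreal_powr u r"
proof (cases u)
  case (real b)
  with assms obtain a where "t = ennreal a" "0 \<le> a" "a \<le> b"
    by (cases t) (auto simp: top_unique)
  with real assms show ?thesis
    by (simp add: ennreal_powr_ennreal powr_mono2 ennreal_leI)
qed (simp add: ennreal_powr_def)

lemma ennreal_powr_powr_inverse:
  assumes "r \<noteq> 0"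
  shows "ennreal_powr (ennreal_powr t r) (1 / r) = t"
proof (cases t)
  case (real a)
  have "(a powr r) powr (1 / r) = a"
    using assms real(1) by (simp add: powr_powr)
  then show ?thesis
    using real by (simp add: ennreal_powr_ennreal)
next
  case top
  then show ?thesis
    by (simp add: ennreal_powr_def)
qed

text \<open>The power with exponent \<open>r\<close> is monotone and has the power with exponent \<open>1 / r\<close> as its monotone
  inverse, so it respects suprema.\<close>

lemma ennreal_powr_SUP_le:
  assumes r: "0 < r" and le: "\<And>i. i \<in> I \<Longrightarrow> ennreal_powr (u i) r \<le> y"
  shows "ennreal_powr (SUP i\<in>I. u i) r \<le> y"
proof -
  have "u i \<le> ennreal_powr y (1 / r)" if "i \<in> I" for i
    using ennreal_powr_mono[OF le[OF that], of "1 / r"] r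
    by (simp add: ennreal_powr_powr_inverse)
  then have "(SUP i\<in>I. u i) \<le> ennreal_powr y (1 / r)"
    by (rule SUP_least)
  from ennreal_powr_mono[OF this, of r] r show ?thesis
    using ennreal_powr_powr_inverse[of "1 / r" y] by simp
qed

section \<open>Measurability and compact exhaustion\<close>

lemma weight_borel_measurable:
  fixes w :: "'a::euclidean_space \<Rightarrow> real"
  assumes "weight w"
  shows "w \<in> borel_measurable lebesgue"
proof (rule borel_measurable_LIMSEQ_real)
  show "(\<lambda>k. indicator (cball 0 (real k)) x * w x) \<longlonglongrightarrow> w x" for x
  proof (rule tendsto_eventually)
    obtain N where N: "norm x \<le> real N"
      using real_arch_simple by blast
    show "\<forall>\<^sub>F k in sequentially. indicator (cball 0 (real k)) x * w x = w x"
      using eventually_ge_at_top[of N]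
      by eventually_elim (use N in \<open>auto simp: indicator_def\<close>)
  qed
  show "(\<lambda>x. indicator (cball 0 (real k)) x * w x) \<in> borel_measurable lebesgue" for k
    using assms by (intro borel_measurable_integrable) (auto simp: weight_def set_integrable_def)
qed

text \<open>Inner regularity is applied to each of the sets \<open>{x \<in> S. \<bar>h x\<bar> \<le> k}\<close> separately: this makes \<open>h\<close>
  bounded on the compact sets, although \<open>h\<close> need not be locally bounded.\<close>

lemma compact_exhaustion_bounded:
  fixes S :: "'a::euclidean_space set" and h :: "'a \<Rightarrow> real"
  assumes S: "S \<in> sets lebesgue" and h: "h \<in> borel_measurable lebesgue"
  obtains F :: "nat \<Rightarrow> 'a set"
  where "incseq F" "\<And>m. compact (F m)" "\<And>m. F m \<subseteq> S"
    "\<And>m x. x \<in> F m \<Longrightarrow> \<bar>h x\<bar> \<le> real m" "AE x in lebesgue. x \<in> S \<longrightarrow> (\<exists>m. x \<in> F m)"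
proof -
  define A where "A k = {x \<in> S. \<bar>h x\<bar> \<le> real k}" for k :: nat
  have "A k \<in> sets lebesgue" for k
  proof -
    have "A k = S \<inter> {x \<in> space lebesgue. \<bar>h x\<bar> \<le> real k}"
      by (auto simp: A_def)
    then show ?thesis
      using S h by simp
  qed
  then have "\<exists>C N. (\<forall>n::nat. compact (C n)) \<and> (\<forall>n. C n \<subseteq> A k) \<and> negligible N \<and> A k = (\<Union>n. C n) \<union> N" for k
    by (metis lebesgue_regular_inner UN_upper Un_upper1 subset_trans UNIV_I)
  then obtain C :: "nat \<Rightarrow> nat \<Rightarrow> 'a set" and N :: "nat \<Rightarrow> 'a set"
    where C: "\<And>k n. compact (C k n)" "\<And>k n. C k n \<subseteq> A k"
      and N: "\<And>k. negligible (N k)" "\<And>k. A k = (\<Union>n. C k n) \<union> N k"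
    by metis
  define F where "F m = (\<Union>k\<le>m. \<Union>n\<le>m. C k n)" for m
  show ?thesis
  proof
    show "incseq F"
      by (rule monoI) (fastforce simp: F_def)
    show "compact (F m)" for m
      unfolding F_def using C(1) by (intro compact_UN) auto
    show "F m \<subseteq> S" for m
      using C(2) by (force simp: F_def A_def)
    show "\<bar>h x\<bar> \<le> real m" if "x \<in> F m" for m x
      using that C(2) by (force simp: F_def A_def)
    have "AE x in lebesgue. \<forall>k. x \<notin> N k"
      unfolding AE_all_countable
      using N(1) by (auto simp: negligible_iff_null_sets intro: AE_not_in)
    then show "AE x in lebesgue. x \<in> S \<longrightarrow> (\<exists>m. x \<in> F m)"
    proof eventually_elim
      case (elim x)
      show ?case
      proof
        assume "x \<in> S"
        moreover obtain k where "\<bar>h x\<bar> \<le> real k"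
          using real_arch_simple by blast
        ultimately have "x \<in> A k"
          by (simp add: A_def)
        then obtain n where "x \<in> C k n"
          using N(2) elim by blast
        then have "x \<in> F (max k n)"
          unfolding F_def by (intro UN_I[of k] UN_I[of n]) auto
        then show "\<exists>m. x \<in> F m" ..
      qed
    qed
  qed
qed

section \<open>Testing the operator on functions with the conjugate phase\<close>

text \<open>Such a function lies in \<open>L\<^sup>q\<close> for every \<open>q\<close>; the proof uses \<open>q = 2\<close>.\<close>

lemma bounded_compact_support_test_function:
  fixes f :: "'a::euclidean_space \<Rightarrow> complex"
  assumes f: "f \<in> borel_measurable lebesgue" and F: "compact F" "\<And>x. x \<notin> F \<Longrightarrow> f x = 0"
    and bound: "AE x in lebesgue. cmod (f x) \<le> B"
  shows "f \<in> test_functions"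
proof -
  have "supp f \<subseteq> F"
    unfolding supp_def using F
    by (intro closure_minimal) (auto simp: support_on_def compact_imp_closed)
  then have "compact (supp f)"
    using F(1) closed_Int_compact[of "supp f" F] by (simp add: supp_def Int_absorb2)
  moreover have "Lp_norm 2 (\<lambda>_. 1) f < \<infinity>"
  proof -
    have "(\<integral>\<^sup>+x. ennreal (cmod (f x) powr 2 * 1) \<partial>lebesgue)
        \<le> (\<integral>\<^sup>+x. ennreal (B powr 2) * indicator F x \<partial>lebesgue)"
    proof (rule nn_integral_mono_AE, use bound in eventually_elim)
      case (elim x)
      then have "cmod (f x) powr 2 \<le> B powr 2"
        by (intro powr_mono2) auto
      then show ?case
        using F(2)[of x] by (cases "x \<in> F") (auto simp del: powr_numeral intro!: ennreal_leI)
    qed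
    also have "\<dots> = ennreal (B powr 2) * emeasure lebesgue F"
      using F(1) by (intro nn_integral_cmult_indicator) (simp add: fmeasurableD lmeasurable_compact)
    also have "\<dots> < \<infinity>"
      using fmeasurableD2[OF lmeasurable_compact[OF F(1)]]
      by (simp add: ennreal_mult_less_top less_top del: emeasure_completion)
    finally show ?thesis
      by (simp add: Lp_norm_def ennreal_powr_def)
  qed
  ultimately show ?thesis
    using f by (auto simp: test_functions_def Lp_space_def L0_def intro!: exI[of _ 2])
qed

text \<open>For \<open>f = s \<cdot> g\<close> and almost every \<open>x\<close> with \<open>\<phi> x \<noteq> 0\<close>, the real part of \<open>K x y * f y\<close> is at least
  \<open>\<phi> x * (\<psi> y * g y)\<close> for almost every \<open>y\<close>, so the real part of \<open>T f x\<close> is already large.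
  As \<open>F\<close> is closed, it contains the closed support of \<open>f\<close>; it meets the
  set where \<open>\<phi>\<close> does not vanish in a null set only, so that the integral formula for \<open>T f\<close>
  is available almost everywhere on that set.\<close>

lemma kernel_operator_test_lower_bound:
  fixes K :: "'a::euclidean_space \<Rightarrow> 'a \<Rightarrow> complex" and \<phi> \<psi> g :: "'a \<Rightarrow> real"
  assumes T: "kernel_operator D T K"
    and f: "(\<lambda>y. s y * complex_of_real (g y)) \<in> test_functions"
    and \<phi>: "\<phi> \<in> borel_measurable lebesgue" "AE x in lebesgue. 0 \<le> \<phi> x"
    and null: "support_on UNIV \<phi> \<inter> support_on UNIV \<psi> \<in> null_sets lebesgue"
    and low: "kernel_lower_bound K s \<phi> \<psi>"
    and X: "monotone_functional X"
    and F: "closed F" "F \<subseteq> support_on UNIV \<psi>"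
    and g: "\<And>y. 0 \<le> g y" "\<And>y. y \<notin> F \<Longrightarrow> g y = 0"
    and int: "integrable lebesgue (\<lambda>y. \<psi> y * g y)" "0 \<le> (\<integral>y. \<psi> y * g y \<partial>lebesgue)"
  shows "ennreal (\<integral>y. \<psi> y * g y \<partial>lebesgue) * X (\<lambda>x. complex_of_real (\<phi> x))
      \<le> X (T (\<lambda>y. s y * complex_of_real (g y)))"
proof -
  define f where "f = (\<lambda>y. s y * complex_of_real (g y))"
  define c where "c = (\<integral>y. \<psi> y * g y \<partial>lebesgue)"
  have supp: "supp f \<subseteq> F"
    unfolding supp_def using F(1) g(2)
    by (intro closure_minimal) (auto simp: support_on_def f_def)
  have rep: "AE x in lebesgue. x \<notin> supp f \<longrightarrow>
      integrable lebesgue (\<lambda>y. K x y * f y) \<and> T f x = (\<integral>y. K x y * f y \<partial>lebesgue)"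
    using T f unfolding kernel_operator_def f_def by blast
  have "AE x in lebesgue. cmod (complex_of_real c * complex_of_real (\<phi> x)) \<le> cmod (T f x)"
    using rep \<phi>(2) AE_not_in[OF null] low[unfolded kernel_lower_bound_def]
  proof eventually_elim
    case (elim x)
    show ?case
    proof (cases "\<phi> x = 0")
      case False
      then have x: "x \<in> support_on UNIV \<phi>"
        by (simp add: support_on_def)
      then have "x \<notin> supp f"
        using elim(3) F(2) supp by blast
      with elim(1) have Kf: "integrable lebesgue (\<lambda>y. K x y * f y)"
        and Tf: "T f x = (\<integral>y. K x y * f y \<partial>lebesgue)"
        by auto
      have ae: "AE y in lebesgue. \<phi> x * (\<psi> y * g y) \<le> Re (K x y * f y)"
        using elim(4)[rule_format, OF x]
      proof eventually_elim
        case (elim y)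
        have Re: "Re (K x y * f y) = Re (s y * K x y) * g y"
          by (simp add: f_def algebra_simps)
        show ?case
        proof (cases "y \<in> F")
          case True
          then have "\<phi> x * \<psi> y \<le> Re (s y * K x y)"
            using elim F(2) by blast
          from mult_right_mono[OF this g(1)[of y]] show ?thesis
            unfolding Re by (simp add: mult.assoc)
        qed (use g(2) Re in simp)
      qed
      have "\<phi> x * c = (\<integral>y. \<phi> x * (\<psi> y * g y) \<partial>lebesgue)"
        by (simp add: c_def)
      also have "\<dots> \<le> (\<integral>y. Re (K x y * f y) \<partial>lebesgue)"
        by (intro integral_mono_AE integrable_mult_right integrable_Re int(1) Kf ae)
      also have "\<dots> = Re (T f x)"
        unfolding Tf by (rule integral_Re[OF Kf])
      also have "\<dots> \<le> cmod (T f x)"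
        by (rule complex_Re_le_cmod)
      finally show ?thesis
        using elim(2) int(2) by (simp add: norm_mult c_def mult.commute)
    qed simp
  qed
  moreover have "T f \<in> L0"
    using T f unfolding kernel_operator_def f_def by blast
  moreover have L0: "(\<lambda>x. complex_of_real (\<phi> x)) \<in> L0"
      "(\<lambda>x. complex_of_real c * complex_of_real (\<phi> x)) \<in> L0"
    using \<phi>(1) by (auto simp: L0_def)
  ultimately have "X (\<lambda>x. complex_of_real c * complex_of_real (\<phi> x)) \<le> X (T f)"
    using X by (simp add: monotone_functional_def)
  moreover have "X (\<lambda>x. complex_of_real c * complex_of_real (\<phi> x))
      = ennreal c * X (\<lambda>x. complex_of_real (\<phi> x))"
    using X L0(1) int(2) by (simp add: monotone_functional_def c_def)
  ultimately show ?thesis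
    by (simp add: c_def f_def)
qed

section \<open>The extremal test function\<close>

text \<open>Everything comes from \<open>p (p' - 1) = p'\<close>. With \<open>a = \<psi> y\<close> and \<open>b = w y\<close> this is the pointwise form
  of the case of equality in Hoelder's inequality.\<close>

lemma hoelder_extremal_powr:
  fixes a b p :: real
  assumes "1 < p" "0 < a" "0 < b"
  shows "a * (a powr (conj_exp p - 1) * b powr (1 - conj_exp p)) = a powr conj_exp p * b powr (1 - conj_exp p)"
    and "(a powr (conj_exp p - 1) * b powr (1 - conj_exp p)) powr p * b = a powr conj_exp p * b powr (1 - conj_exp p)"
proof -
  have e: "p * (conj_exp p - 1) = conj_exp p" "p * (1 - conj_exp p) + 1 = 1 - conj_exp p"
    using assms(1) by (simp_all add: conj_exp_def field_simps)
  have "a * a powr (conj_exp p - 1) = a powr conj_exp p"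
    using assms powr_mult_base[of a "conj_exp p - 1"] by simp
  then show "a * (a powr (conj_exp p - 1) * b powr (1 - conj_exp p)) = a powr conj_exp p * b powr (1 - conj_exp p)"
    by (simp flip: mult.assoc)
  have "b powr (p * (1 - conj_exp p)) * b = b powr (p * (1 - conj_exp p) + 1)"
    using assms by (simp add: powr_add)
  then show "(a powr (conj_exp p - 1) * b powr (1 - conj_exp p)) powr p * b = a powr conj_exp p * b powr (1 - conj_exp p)"
    using assms e by (simp add: powr_mult powr_powr mult.commute mult.left_commute)
qed

text \<open>The constant \<open>c\<close> is the integral of \<open>\<psi>\<^bsup>p'\<^esup> \<sigma>\<close> over \<open>F\<close>. If it vanishes, so does the left-hand side,
  even when \<open>X \<phi> = \<infinity>\<close>; otherwise it may be cancelled from \<open>c X \<phi> \<le> C c\<^bsup>1/p\<^esup>\<close>.\<close>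

lemma kernel_operator_compact_lower_bound:
  fixes K :: "'a::euclidean_space \<Rightarrow> 'a \<Rightarrow> complex" and \<phi> \<psi> w :: "'a \<Rightarrow> real" and p :: real
  defines "u \<equiv> \<lambda>y. \<psi> y powr (conj_exp p - 1) * w y powr (1 - conj_exp p)"
  assumes T: "kernel_operator D T K"
    and s: "s \<in> borel_measurable lebesgue"
    and \<phi>: "\<phi> \<in> borel_measurable lebesgue" "AE x in lebesgue. 0 \<le> \<phi> x"
    and meas: "\<psi> \<in> borel_measurable lebesgue" "w \<in> borel_measurable lebesgue"
    and null: "support_on UNIV \<phi> \<inter> support_on UNIV \<psi> \<in> null_sets lebesgue"
    and low: "kernel_lower_bound K s \<phi> \<psi>"
    and p: "1 < p" and X: "monotone_functional X"
    and F: "compact F" "\<And>y. y \<in> F \<Longrightarrow> 0 < \<psi> y \<and> 0 < w y \<and> cmod (s y) = 1"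
    and bd: "\<And>y. y \<in> F \<Longrightarrow> \<psi> y \<le> B \<and> u y \<le> B"
    and C: "\<And>f. f \<in> D \<inter> Lp_space p w \<Longrightarrow> X (T f) \<le> ennreal C * Lp_norm p w f"
  shows "X (\<lambda>x. complex_of_real (\<phi> x)) *
      ennreal_powr (\<integral>\<^sup>+y\<in>F. ennreal (\<psi> y powr conj_exp p * w y powr (1 - conj_exp p)) \<partial>lebesgue)
        (1 / conj_exp p) \<le> ennreal C"
proof -
  define g where "g = (\<lambda>y. indicator F y * u y)"
  define f where "f = (\<lambda>y. s y * complex_of_real (g y))"
  define c where "c = (\<integral>y. \<psi> y * g y \<partial>lebesgue)"
  have Fs [measurable]: "F \<in> sets lebesgue"
    using F(1) by (simp add: fmeasurableD lmeasurable_compact)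
  note [measurable] = s meas
  have u0: "0 \<le> u y" for y
    by (simp add: u_def)
  have g_meas [measurable]: "g \<in> borel_measurable lebesgue"
    unfolding g_def u_def by measurable
  have gB: "cmod (f y) \<le> \<bar>B\<bar>" for y
    using F(2)[of y] bd[of y] u0[of y]
    by (cases "y \<in> F") (auto simp: f_def g_def norm_mult)
  have "f \<in> borel_measurable lebesgue"
    unfolding f_def by measurable
  then have f: "f \<in> test_functions"
    using F(1) gB by (intro bounded_compact_support_test_function[where F = F]) (auto simp: f_def g_def)
  have \<psi>g: "\<psi> y * g y = indicator F y * (\<psi> y powr conj_exp p * w y powr (1 - conj_exp p))" for y
    using hoelder_extremal_powr(1)[OF p, of "\<psi> y" "w y"] F(2)[of y]
    by (auto simp: g_def u_def indicator_def)
  have \<psi>g0: "0 \<le> \<psi> y * g y" for y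
    unfolding \<psi>g by simp
  have int: "integrable lebesgue (\<lambda>y. \<psi> y * g y)"
  proof (rule Bochner_Integration.integrable_bound)
    show "integrable lebesgue (\<lambda>y. B * B * indicator F y :: real)"
      using fmeasurableD2[OF lmeasurable_compact[OF F(1)]] Fs
      by (intro integrable_mult_right integrable_real_indicator) (simp_all add: less_top del: emeasure_completion)
    show "AE y in lebesgue. norm (\<psi> y * g y) \<le> norm (B * B * indicator F y :: real)"
    proof (rule AE_I2)
      fix y
      show "norm (\<psi> y * g y) \<le> norm (B * B * indicator F y :: real)"
      proof (cases "y \<in> F")
        case True
        then have "\<psi> y * u y \<le> B * B"
          using F(2)[of y] bd[of y] u0[of y] by (intro mult_mono) auto
        then show ?thesis
          using True F(2)[of y] u0[of y] by (simp add: g_def abs_mult)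
      qed (simp add: g_def)
    qed
  qed measurable
  have c0: "0 \<le> c"
    unfolding c_def using \<psi>g0 by (intro integral_nonneg_AE) simp
  have c: "(\<integral>\<^sup>+y. ennreal (\<psi> y * g y) \<partial>lebesgue) = ennreal c"
    unfolding c_def using int \<psi>g0 by (intro nn_integral_eq_integral) auto
  have cF: "(\<integral>\<^sup>+y\<in>F. ennreal (\<psi> y powr conj_exp p * w y powr (1 - conj_exp p)) \<partial>lebesgue) = ennreal c"
    unfolding c[symmetric] \<psi>g by (intro nn_integral_cong) (auto simp: indicator_def)
  have "cmod (f y) powr p * w y = \<psi> y * g y" for y
    using hoelder_extremal_powr(2)[OF p, of "\<psi> y" "w y"] F(2)[of y] u0[of y] p
    unfolding \<psi>g by (cases "y \<in> F") (auto simp: f_def g_def u_def norm_mult)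
  then have norm_f: "Lp_norm p w f = ennreal (c powr (1 / p))"
    using c0 by (simp add: Lp_norm_def c ennreal_powr_ennreal)
  have "f \<in> D \<inter> Lp_space p w"
    using f T norm_f \<open>f \<in> borel_measurable lebesgue\<close>
    by (auto simp: kernel_operator_def Lp_space_def L0_def)
  note C[OF this]
  moreover have "ennreal c * X (\<lambda>x. complex_of_real (\<phi> x)) \<le> X (T f)"
    unfolding c_def f_def
  proof (rule kernel_operator_test_lower_bound[OF T _ \<phi> null low X, where F = F])
    show "F \<subseteq> support_on UNIV \<psi>"
      using F(2) by (force simp: support_on_def)
  qed (use f F(1) int c0 u0 in \<open>auto simp: f_def c_def g_def compact_imp_closed\<close>)
  ultimately have main: "ennreal c * X (\<lambda>x. complex_of_real (\<phi> x)) \<le> ennreal C * ennreal (c powr (1 / p))"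
    by (simp add: norm_f)
  have e: "1 / conj_exp p = 1 - 1 / p"
    using p by (simp add: conj_exp_def field_simps)
  show ?thesis
  proof (cases "c = 0")
    case True
    then show ?thesis
      by (simp add: cF ennreal_powr_def)
  next
    case False
    with c0 have pos: "0 < c" by simp
    have "c powr (1 / conj_exp p) = c powr (- (1 / p)) * c"
      using pos powr_mult_base[of c "- (1 / p)"] by (simp add: e mult.commute)
    then have split: "ennreal (c powr (1 / conj_exp p)) = ennreal (c powr (- (1 / p))) * ennreal c"
      using c0 by (simp only: ennreal_mult powr_ge_zero)
    have "X (\<lambda>x. complex_of_real (\<phi> x)) * ennreal (c powr (1 / conj_exp p))
        = ennreal (c powr (- (1 / p))) * (ennreal c * X (\<lambda>x. complex_of_real (\<phi> x)))"
      unfolding split by (simp only: mult_ac)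
    also have "\<dots> \<le> ennreal (c powr (- (1 / p))) * (ennreal C * ennreal (c powr (1 / p)))"
      using main by (rule mult_left_mono) simp
    also have "\<dots> = ennreal C * ennreal (c powr (- (1 / p)) * c powr (1 / p))"
      by (simp only: ennreal_mult powr_ge_zero mult_ac)
    also have "\<dots> = ennreal C"
      using pos by (simp flip: powr_add)
    finally show ?thesis
      using c0 by (simp add: cF ennreal_powr_ennreal)
  qed
qed

section \<open>The lower bound for the operator norm\<close>

theorem theorem1p4:
  fixes D :: "((real ^ 'n) \<Rightarrow> complex) set"
    and T :: "((real ^ 'n) \<Rightarrow> complex) \<Rightarrow> (real ^ 'n) \<Rightarrow> complex"
    and K :: "(real ^ 'n) \<Rightarrow> (real ^ 'n) \<Rightarrow> complex"
    and s :: "(real ^ 'n) \<Rightarrow> complex"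
    and \<phi> \<psi> w :: "(real ^ 'n) \<Rightarrow> real"
    and X :: "((real ^ 'n) \<Rightarrow> complex) \<Rightarrow> ennreal"
    and p :: real
  assumes "kernel_operator D T K"
    and "s \<in> borel_measurable lebesgue" and "\<phi> \<in> borel_measurable lebesgue"
    and "\<psi> \<in> borel_measurable lebesgue"
    and "AE x in lebesgue. cmod (s x) = 1"
    and "AE x in lebesgue. 0 \<le> \<phi> x" and "AE x in lebesgue. 0 \<le> \<psi> x"
    and "support_on UNIV \<phi> \<inter> support_on UNIV \<psi> \<in> null_sets lebesgue"
    and "kernel_lower_bound K s \<phi> \<psi>"
    and "1 < p" and "w \<in> Ap p" and "monotone_functional X"
  shows "operator_norm D T p w X \<ge>
    X (\<lambda>x. complex_of_real (\<phi> x)) *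
    Lp_norm (conj_exp p) (\<lambda>x. w x powr (1 - conj_exp p)) (\<lambda>x. complex_of_real (\<psi> x))"
proof -
  \<comment> \<open>Up to a null set, \<open>S\<close> is the set where \<open>\<psi>\<close> does not vanish.\<close>
  define S where "S = {y. 0 < \<psi> y \<and> 0 < w y \<and> cmod (s y) = 1}"
  define u where "u = (\<lambda>y. \<psi> y powr (conj_exp p - 1) * w y powr (1 - conj_exp p))"
  define v where "v = (\<lambda>y. ennreal (\<psi> y powr conj_exp p * w y powr (1 - conj_exp p)))"
  have weight: "weight w"
    using assms(11) by (simp add: Ap_def)
  then have w: "w \<in> borel_measurable lebesgue" "AE y in lebesgue. 0 < w y"
    by (simp_all add: weight_borel_measurable) (simp add: weight_def)
  note [measurable] = assms(2,4) w(1)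
  have pos: "0 < 1 / conj_exp p"
    using assms(10) by (simp add: conj_exp_def)
  have "S = {y \<in> space lebesgue. 0 < \<psi> y \<and> 0 < w y \<and> cmod (s y) = 1}"
    by (simp add: S_def)
  then have "S \<in> sets lebesgue"
    by (simp only:) measurable
  moreover have "(\<lambda>y. \<bar>\<psi> y\<bar> + u y) \<in> borel_measurable lebesgue"
    unfolding u_def by measurable
  ultimately obtain F :: "nat \<Rightarrow> (real ^ 'n) set"
    where F: "incseq F" "\<And>m. compact (F m)" "\<And>m. F m \<subseteq> S"
      and bd: "\<And>m x. x \<in> F m \<Longrightarrow> \<bar>\<bar>\<psi> x\<bar> + u x\<bar> \<le> real m"
      and fill: "AE x in lebesgue. x \<in> S \<longrightarrow> (\<exists>m. x \<in> F m)"
    using compact_exhaustion_bounded by blast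
  have Fs [measurable]: "F m \<in> sets lebesgue" for m
    using F(2) by (simp add: fmeasurableD lmeasurable_compact)
  have v_meas [measurable]: "v \<in> borel_measurable lebesgue"
    unfolding v_def by measurable
  have "(\<integral>\<^sup>+y. ennreal (cmod (complex_of_real (\<psi> y)) powr conj_exp p * w y powr (1 - conj_exp p)) \<partial>lebesgue)
      = (\<integral>\<^sup>+y. (SUP m. v y * indicator (F m) y) \<partial>lebesgue)"
  proof (rule nn_integral_cong_AE, use fill w(2) assms(5,7) in eventually_elim)
    case (elim y)
    show ?case
    proof (cases "\<psi> y = 0")
      case False
      with elim obtain k where k: "y \<in> F k"
        by (auto simp: S_def)
      have "(SUP m. v y * indicator (F m) y) = v y"
        by (rule antisym) (use k in \<open>auto intro!: SUP_least SUP_upper2[of k] simp: indicator_def\<close>)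
      with elim show ?thesis
        by (simp add: v_def)
    qed (use pos in \<open>simp add: v_def\<close>)
  qed
  also have "\<dots> = (SUP m. \<integral>\<^sup>+y\<in>F m. v y \<partial>lebesgue)"
    using F(1) by (intro nn_integral_monotone_convergence_SUP)
      (auto simp: incseq_def le_fun_def indicator_def)
  finally have norm: "Lp_norm (conj_exp p) (\<lambda>x. w x powr (1 - conj_exp p)) (\<lambda>x. complex_of_real (\<psi> x))
      = ennreal_powr (SUP m. \<integral>\<^sup>+y\<in>F m. v y \<partial>lebesgue) (1 / conj_exp p)"
    by (simp add: Lp_norm_def)
  show ?thesis
    unfolding operator_norm_def
  proof (rule Inf_greatest, clarify)
    fix C :: real
    assume C: "\<forall>f\<in>D \<inter> Lp_space p w. X (T f) \<le> ennreal C * Lp_norm p w f"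
    have le: "X (\<lambda>x. complex_of_real (\<phi> x)) * ennreal_powr (\<integral>\<^sup>+y\<in>F m. v y \<partial>lebesgue) (1 / conj_exp p) \<le> ennreal C" for m
      unfolding v_def
    proof (rule kernel_operator_compact_lower_bound[OF assms(1-3) assms(6) assms(4) w(1) assms(8-10,12) F(2),
          where B = "real m"])
      show "0 < \<psi> y \<and> 0 < w y \<and> cmod (s y) = 1" if "y \<in> F m" for y
        using that F(3) by (auto simp: S_def)
      show "\<psi> y \<le> real m \<and> \<psi> y powr (conj_exp p - 1) * w y powr (1 - conj_exp p) \<le> real m"
        if "y \<in> F m" for y
        using bd[OF that] by (auto simp: u_def) (smt (verit) mult_nonneg_nonneg powr_ge_zero)+
    qed (use C in blast)
    have "X (\<lambda>x. complex_of_real (\<phi> x)) *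
        ennreal_powr (SUP m. \<integral>\<^sup>+y\<in>F m. v y \<partial>lebesgue) (1 / conj_exp p)
      \<le> X (\<lambda>x. complex_of_real (\<phi> x)) *
        (SUP m. ennreal_powr (\<integral>\<^sup>+y\<in>F m. v y \<partial>lebesgue) (1 / conj_exp p))"
      by (intro mult_left_mono ennreal_powr_SUP_le pos SUP_upper) auto
    also have "\<dots> \<le> ennreal C"
      unfolding SUP_mult_left_ennreal by (intro SUP_least le)
    finally show "X (\<lambda>x. complex_of_real (\<phi> x)) *
        Lp_norm (conj_exp p) (\<lambda>x. w x powr (1 - conj_exp p)) (\<lambda>x. complex_of_real (\<psi> x)) \<le> ennreal C"
      by (simp add: norm)
  qed
qed

end
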